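(* Let $\mathcal A=(A,\cdot,[\cdot,\cdot],\varepsilon)$ be a Gelfand-Dorfman color Hom-algebra and let $\alpha:\mathcal A\to\mathcal A$ be a morphism of Gelfand-Dorfman color Hom-algebras. Define $\cdot_\alpha,[\cdot,\cdot]_\alpha:A\times A\to A$, for all $x,y\in\mathcal H(A)$, by $x\cdot_\alpha y=\alpha(x\cdot y)$ and $[x,y]_\alpha=\alpha([x,y])$. Then $\mathcal A_\alpha=(A,\cdot_\alpha,[\cdot,\cdot]_\alpha,\varepsilon,\alpha)$ is a Hom-Gelfand-Dorfman color Hom-algebra. Moreover, assume that $\mathcal A'=(A',\cdot',[\cdot,\cdot]',\varepsilon)$ is another Gelfand-Dorfman color Hom-algebra and $\alpha':\mathcal A'\to\mathcal A'$ is a morphism of Gelfand-Dorfman color Hom-algebras. Let $f:\mathcal A\to\mathcal A'$ be a morphism of Gelfand-Dorfman color Hom-algebras satisfying $f\circ\alpha=\alpha'\circ f$. Then $f:\mathcal A_\alpha\to\mathcal A'_{\alpha'}$ is a morphism of Hom-Gelfand-Dorfman color Hom-algebras, where $\mathcal A'_{\alpha'}=(A',\cdot'_{\alpha'}=\alpha'\circ\cdot',[\cdot,\cdot]'_{\alpha'}=\alpha'\circ[\cdot,\cdot]',\varepsilon,\alpha')$.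
   Context: $\mathbb K$ is an algebraically closed field of characteristic $0$; all spaces are over $\mathbb K$. $\Gamma$ is an abelian group and $\varepsilon:\Gamma\times\Gamma\to\mathbb K^*=\mathbb K\setminus\{0\}$ is a commutation factor: $\varepsilon(a,b)\varepsilon(b,a)=1$, $\varepsilon(a,b+c)=\varepsilon(a,b)\varepsilon(a,c)$, $\varepsilon(a+b,c)=\varepsilon(a,c)\varepsilon(b,c)$. For a $\Gamma$-graded linear space $V$, $\mathcal H(V)$ is the set of homogeneous elements; inside $\varepsilon$ a homogeneous element stands for its degree (so $\varepsilon(x+y,z)=\varepsilon(\deg x+\deg y,\deg z)$). A linear map is even if it preserves degrees; a bilinear multiplication on $A$ is even if $A_\gamma A_{\gamma'}\subseteq A_{\gamma+\gamma'}$. A color Hom-algebra $(A,\cdot,\varepsilon,\alpha)$ is a $\Gamma$-graded space $A$ with an even bilinear multiplication $\cdot$ and an even linear map $\alpha:A\to A$ (not assumed multiplicative). All identities are for all homogeneous $x,y,z$. Hom-Novikov color Hom-algebra $(A,\cdot,\varepsilon,\alpha)$: $(x\cdot y)\cdot\alpha(z)-\alpha(x)\cdot(y\cdot z)=\varepsilon(x,y)\big((y\cdot x)\cdot\alpha(z)-\alpha(y)\cdot(x\cdot z)\big)$ and $(x\cdot y)\cdot\alpha(z)=\varepsilon(y,z)(x\cdot z)\cdot\alpha(y)$. Hom-Lie color Hom-algebra $(A,[\cdot,\cdot],\varepsilon,\alpha)$: $[\cdot,\cdot]$ even bilinear, $\alpha$ even linear, $[x,y]=-\varepsilon(x,y)[y,x]$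 and $\circlearrowleft_{x,y,z}\varepsilon(z,x)[\alpha(x),[y,z]]=0$ (cyclic sum over $(x,y,z)$). Hom-Gelfand-Dorfman color Hom-algebra $(A,\cdot,[\cdot,\cdot],\varepsilon,\alpha)$: $(A,\cdot,\varepsilon,\alpha)$ is Hom-Novikov, $(A,[\cdot,\cdot],\varepsilon,\alpha)$ is Hom-Lie, and $\alpha(y)\cdot[x,z]=\varepsilon(y,x)[\alpha(x),y\cdot z]-\varepsilon(x+y,z)[\alpha(z),y\cdot x]+[y,x]\cdot\alpha(z)-\varepsilon(x,z)[y,z]\cdot\alpha(x)$. A Gelfand-Dorfman color Hom-algebra $(A,\cdot,[\cdot,\cdot],\varepsilon)$ is a Hom-Gelfand-Dorfman color Hom-algebra with twisting map $\mathrm{id}_A$. A morphism of Hom-Gelfand-Dorfman color Hom-algebras $f:(A,\cdot,[\cdot,\cdot],\varepsilon,\alpha)\to(A',\cdot',[\cdot,\cdot]',\varepsilon,\alpha')$ is an even linear map with $f(x\cdot y)=f(x)\cdot' f(y)$, $f([x,y])=[f(x),f(y)]'$ and $f\circ\alpha=\alpha'\circ f$; for Gelfand-Dorfman color Hom-algebras the last condition is vacuous. *)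

theory Defs
  imports "HOL-Computational_Algebra.Polynomial"
begin

locale commutation_factor =
  fixes eps :: "'g::ab_group_add \<Rightarrow> 'g \<Rightarrow> 'k::field"
  assumes eps_nonzero: "eps a b \<noteq> 0"
    and eps_swap: "eps a b * eps b a = 1"
    and eps_add_right: "eps a (b + c) = eps a b * eps a c"
    and eps_add_left: "eps (a + b) c = eps a c * eps b c"

locale graded_space = vector_space scale
  for scale :: "'k::field \<Rightarrow> 'v::ab_group_add \<Rightarrow> 'v" +
  fixes gr :: "'g::ab_group_add \<Rightarrow> 'v set"
  assumes subspace_gr: "subspace (gr g)"
    and direct_sum: "\<exists>!c. (\<forall>g. c g \<in> gr g) \<and> finite {g. c g \<noteq> 0} \<and> v = (\<Sum>g | c g \<noteq> 0. c g)"

definition even_linear ::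
  "('k::field \<Rightarrow> 'v::ab_group_add \<Rightarrow> 'v) \<Rightarrow> ('g \<Rightarrow> 'v set) \<Rightarrow>
   ('k \<Rightarrow> 'w::ab_group_add \<Rightarrow> 'w) \<Rightarrow> ('g \<Rightarrow> 'w set) \<Rightarrow> ('v \<Rightarrow> 'w) \<Rightarrow> bool" where
  "even_linear scale gr scale' gr' f \<longleftrightarrow>
     Vector_Spaces.linear scale scale' f \<and> (\<forall>g. \<forall>x\<in>gr g. f x \<in> gr' g)"

definition even_bilinear ::
  "('k::field \<Rightarrow> 'v::ab_group_add \<Rightarrow> 'v) \<Rightarrow> ('g::ab_group_add \<Rightarrow> 'v set) \<Rightarrow>
   ('v \<Rightarrow> 'v \<Rightarrow> 'v) \<Rightarrow> bool" where
  "even_bilinear scale gr m \<longleftrightarrow>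
     (\<forall>x. Vector_Spaces.linear scale scale (\<lambda>y. m x y)) \<and>
     (\<forall>y. Vector_Spaces.linear scale scale (\<lambda>x. m x y)) \<and>
     (\<forall>g h. \<forall>x\<in>gr g. \<forall>y\<in>gr h. m x y \<in> gr (g + h))"

locale color_hom_algebra =
  graded_space scale gr + commutation_factor eps
  for scale :: "'k::field \<Rightarrow> 'v::ab_group_add \<Rightarrow> 'v"
    and gr :: "'g::ab_group_add \<Rightarrow> 'v set"
    and eps :: "'g \<Rightarrow> 'g \<Rightarrow> 'k" +
  fixes mul :: "'v \<Rightarrow> 'v \<Rightarrow> 'v" and \<alpha> :: "'v \<Rightarrow> 'v"
  assumes even_bilinear_mul: "even_bilinear scale gr mul"
    and even_linear_twist: "even_linear scale gr scale gr \<alpha>"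

text \<open>
  Identities between homogeneous elements are quantified over degrees together with elements of
  the corresponding components. The zero vector thus occurs with every degree, which is harmless:
  the identities are multilinear, so they hold trivially as soon as one argument is zero.
\<close>

locale hom_novikov_color = color_hom_algebra scale gr eps mul \<alpha>
  for scale :: "'k::field \<Rightarrow> 'v::ab_group_add \<Rightarrow> 'v"
    and gr :: "'g::ab_group_add \<Rightarrow> 'v set"
    and eps :: "'g \<Rightarrow> 'g \<Rightarrow> 'k"
    and mul :: "'v \<Rightarrow> 'v \<Rightarrow> 'v" (infixl "\<cdot>" 70)
    and \<alpha> :: "'v \<Rightarrow> 'v" +
  assumes left_symmetric:
    "\<lbrakk>x \<in> gr a; y \<in> gr b; z \<in> gr c\<rbrakk> \<Longrightarrow>
       (x \<cdot> y) \<cdot> \<alpha> z - \<alpha> x \<cdot> (y \<cdot> z) =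
       scale (eps a b) ((y \<cdot> x) \<cdot> \<alpha> z - \<alpha> y \<cdot> (x \<cdot> z))"
    and right_commutative:
    "\<lbrakk>x \<in> gr a; y \<in> gr b; z \<in> gr c\<rbrakk> \<Longrightarrow>
       (x \<cdot> y) \<cdot> \<alpha> z = scale (eps b c) ((x \<cdot> z) \<cdot> \<alpha> y)"

locale hom_lie_color = color_hom_algebra scale gr eps br \<alpha>
  for scale :: "'k::field \<Rightarrow> 'v::ab_group_add \<Rightarrow> 'v"
    and gr :: "'g::ab_group_add \<Rightarrow> 'v set"
    and eps :: "'g \<Rightarrow> 'g \<Rightarrow> 'k"
    and br :: "'v \<Rightarrow> 'v \<Rightarrow> 'v"
    and \<alpha> :: "'v \<Rightarrow> 'v" +
  assumes skew_symmetric: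
    "\<lbrakk>x \<in> gr a; y \<in> gr b\<rbrakk> \<Longrightarrow> br x y = - scale (eps a b) (br y x)"
    and hom_jacobi:
    "\<lbrakk>x \<in> gr a; y \<in> gr b; z \<in> gr c\<rbrakk> \<Longrightarrow>
       scale (eps c a) (br (\<alpha> x) (br y z)) +
       scale (eps a b) (br (\<alpha> y) (br z x)) +
       scale (eps b c) (br (\<alpha> z) (br x y)) = 0"

locale hom_gelfand_dorfman_color =
  nov: hom_novikov_color scale gr eps mul \<alpha> + lie: hom_lie_color scale gr eps br \<alpha>
  for scale :: "'k::field \<Rightarrow> 'v::ab_group_add \<Rightarrow> 'v"
    and gr :: "'g::ab_group_add \<Rightarrow> 'v set"
    and eps :: "'g \<Rightarrow> 'g \<Rightarrow> 'k"
    and mul :: "'v \<Rightarrow> 'v \<Rightarrow> 'v" (infixl "\<cdot>" 70)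
    and br :: "'v \<Rightarrow> 'v \<Rightarrow> 'v"
    and \<alpha> :: "'v \<Rightarrow> 'v" +
  assumes gelfand_dorfman_compat:
    "\<lbrakk>x \<in> gr a; y \<in> gr b; z \<in> gr c\<rbrakk> \<Longrightarrow>
       \<alpha> y \<cdot> br x z =
         scale (eps b a) (br (\<alpha> x) (y \<cdot> z))
         - scale (eps (a + b) c) (br (\<alpha> z) (y \<cdot> x))
         + br y x \<cdot> \<alpha> z
         - scale (eps a c) (br y z \<cdot> \<alpha> x)"

definition gelfand_dorfman_color ::
  "('k::field \<Rightarrow> 'v::ab_group_add \<Rightarrow> 'v) \<Rightarrow> ('g::ab_group_add \<Rightarrow> 'v set) \<Rightarrow> ('g \<Rightarrow> 'g \<Rightarrow> 'k) \<Rightarrow>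
   ('v \<Rightarrow> 'v \<Rightarrow> 'v) \<Rightarrow> ('v \<Rightarrow> 'v \<Rightarrow> 'v) \<Rightarrow> bool" where
  "gelfand_dorfman_color scale gr eps mul br \<longleftrightarrow> hom_gelfand_dorfman_color scale gr eps mul br id"

locale hom_gelfand_dorfman_morphism =
  src: hom_gelfand_dorfman_color scale gr eps mul br \<alpha> +
  tgt: hom_gelfand_dorfman_color scale' gr' eps mul' br' \<alpha>'
  for eps :: "'g::ab_group_add \<Rightarrow> 'g \<Rightarrow> 'k::field"
    and scale :: "'k \<Rightarrow> 'v::ab_group_add \<Rightarrow> 'v" and gr :: "'g \<Rightarrow> 'v set"
    and mul br :: "'v \<Rightarrow> 'v \<Rightarrow> 'v" and \<alpha> :: "'v \<Rightarrow> 'v"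
    and scale' :: "'k \<Rightarrow> 'w::ab_group_add \<Rightarrow> 'w" and gr' :: "'g \<Rightarrow> 'w set"
    and mul' br' :: "'w \<Rightarrow> 'w \<Rightarrow> 'w" and \<alpha>' :: "'w \<Rightarrow> 'w" +
  fixes f :: "'v \<Rightarrow> 'w"
  assumes even_linear_morphism: "even_linear scale gr scale' gr' f"
    and morphism_mul: "f (mul x y) = mul' (f x) (f y)"
    and morphism_br: "f (br x y) = br' (f x) (f y)"
    and morphism_twist: "f \<circ> \<alpha> = \<alpha>' \<circ> f"

definition gelfand_dorfman_morphism ::
  "('g::ab_group_add \<Rightarrow> 'g \<Rightarrow> 'k::field) \<Rightarrow>
   ('k \<Rightarrow> 'v::ab_group_add \<Rightarrow> 'v) \<Rightarrow> ('g \<Rightarrow> 'v set) \<Rightarrow> ('v \<Rightarrow> 'v \<Rightarrow> 'v) \<Rightarrow> ('v \<Rightarrow> 'v \<Rightarrow> 'v) \<Rightarrow>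
   ('k \<Rightarrow> 'w::ab_group_add \<Rightarrow> 'w) \<Rightarrow> ('g \<Rightarrow> 'w set) \<Rightarrow> ('w \<Rightarrow> 'w \<Rightarrow> 'w) \<Rightarrow> ('w \<Rightarrow> 'w \<Rightarrow> 'w) \<Rightarrow>
   ('v \<Rightarrow> 'w) \<Rightarrow> bool" where
  "gelfand_dorfman_morphism eps scale gr mul br scale' gr' mul' br' f \<longleftrightarrow>
     hom_gelfand_dorfman_morphism eps scale gr mul br id scale' gr' mul' br' id f"

end

theory Submission
  imports Defs
begin

text \<open>
  Since \<open>\<alpha>\<close> is multiplicative for both operations, every twisted product of three elements
  with its twisting map equals \<open>\<alpha>\<^sup>2\<close> of the corresponding untwisted product, e.g.
  \<open>(x \<cdot>\<^sub>\<alpha> y) \<cdot>\<^sub>\<alpha> \<alpha>(z) = \<alpha>\<^sup>2((x \<cdot> y) \<cdot> z)\<close>. Hence each ternary axiom of the twisted algebra is the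
  image of the original axiom under the linear map \<open>\<alpha>\<^sup>2\<close>.
\<close>

lemma even_bilinear_compose:
  assumes "even_bilinear scale gr m" and "even_linear scale gr scale gr f"
  shows "even_bilinear scale gr (\<lambda>x y. f (m x y))"
  using assms Vector_Spaces.linear_compose[of scale scale _ scale f]
  unfolding even_bilinear_def even_linear_def comp_def by blast

text \<open>The assumption that \<alpha> is a morphism also carries the Gelfand-Dorfman axioms of
  the algebra itself, available below through \<open>m.src\<close> with twisting map
  \<open>id\<close>.\<close>

lemma hom_gelfand_dorfman_color_twist:
  assumes "gelfand_dorfman_morphism eps scale gr mul br scale gr mul br \<alpha>"
  shows "hom_gelfand_dorfman_color scale gr eps
           (\<lambda>x y. \<alpha> (mul x y)) (\<lambda>x y. \<alpha> (br x y)) \<alpha>"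
proof -
  interpret m: hom_gelfand_dorfman_morphism eps scale gr mul br id scale gr mul br id \<alpha>
    using assms unfolding gelfand_dorfman_morphism_def .
  interpret \<alpha>: Vector_Spaces.linear scale scale \<alpha>
    using m.even_linear_morphism unfolding even_linear_def by blast
  \<comment> \<open>These rules move \<alpha> inward through the linear operations and both products
    until it meets only variables; \<open>id_apply\<close> erases the trivial twist. The image of
    the old axiom and the new axiom then have the same normal form.\<close>
  note push = \<alpha>.add \<alpha>.diff \<alpha>.neg \<alpha>.scale \<alpha>.zero m.morphism_mul m.morphism_br id_apply
  note mul = even_bilinear_compose[OF m.src.nov.even_bilinear_mul m.even_linear_morphism]
  note br = even_bilinear_compose[OF m.src.lie.even_bilinear_mul m.even_linear_morphism]
  show ?thesis
  proof (unfold_locales, goal_cases)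
    case (3 x a y b z c)
    from arg_cong[OF m.src.nov.left_symmetric[OF 3], of "\<lambda>v. \<alpha> (\<alpha> v)"]
    show ?case by (simp only: push)
  next
    case (4 x a y b z c)
    from arg_cong[OF m.src.nov.right_commutative[OF 4], of "\<lambda>v. \<alpha> (\<alpha> v)"]
    show ?case by (simp only: push)
  next
    case (6 x a y b)
    \<comment> \<open>Skew symmetry involves one bracket and no twisting map, so here \<alpha> is
      applied once instead of twice.\<close>
    from arg_cong[OF m.src.lie.skew_symmetric[OF 6], of \<alpha>]
    show ?case by (simp only: push)
  next
    case (7 x a y b z c)
    from arg_cong[OF m.src.lie.hom_jacobi[OF 7], of "\<lambda>v. \<alpha> (\<alpha> v)"]
    show ?case by (simp only: push)
  next
    case (8 x a y b z c)
    from arg_cong[OF m.src.gelfand_dorfman_compat[OF 8], of "\<lambda>v. \<alpha> (\<alpha> v)"]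
    show ?case by (simp only: push)
  \<comment> \<open>The goals left are evenness of the two twisted operations and of
    \<alpha>.\<close>
  qed (fact mul br m.even_linear_morphism)+
qed

text \<open>Intertwining gives \<open>f (\<alpha> (mul x y)) = \<alpha>' (f (mul x y)) = \<alpha>'
  (mul' (f x) (f y))\<close>, and likewise for the brackets. The previous lemma makes source and
  target Hom-Gelfand-Dorfman, and the twist condition is \<open>comm\<close> itself.\<close>

lemma hom_gelfand_dorfman_morphism_twist:
  assumes "gelfand_dorfman_morphism eps scale gr mul br scale gr mul br \<alpha>"
    and "gelfand_dorfman_morphism eps scale' gr' mul' br' scale' gr' mul' br' \<alpha>'"
    and f: "gelfand_dorfman_morphism eps scale gr mul br scale' gr' mul' br' f"
    and comm: "f \<circ> \<alpha> = \<alpha>' \<circ> f"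
  shows "hom_gelfand_dorfman_morphism eps
           scale gr (\<lambda>x y. \<alpha> (mul x y)) (\<lambda>x y. \<alpha> (br x y)) \<alpha>
           scale' gr' (\<lambda>x y. \<alpha>' (mul' x y)) (\<lambda>x y. \<alpha>' (br' x y)) \<alpha>' f"
proof -
  interpret f: hom_gelfand_dorfman_morphism eps scale gr mul br id scale' gr' mul' br' id f
    using f unfolding gelfand_dorfman_morphism_def .
  have "f (\<alpha> v) = \<alpha>' (f v)" for v
    using fun_cong[OF comm, of v] by simp
  then show ?thesis
    using assms(1,2) comm
    by (intro hom_gelfand_dorfman_morphism.intro hom_gelfand_dorfman_morphism_axioms.intro
          hom_gelfand_dorfman_color_twist f.even_linear_morphism)
       (simp_all add: f.morphism_mul f.morphism_br)
qed

theorem theorem4p20: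
  fixes eps :: "'g::ab_group_add \<Rightarrow> 'g \<Rightarrow> 'k::{alg_closed_field, field_char_0}"
    and scale :: "'k \<Rightarrow> 'v::ab_group_add \<Rightarrow> 'v"
    and gr :: "'g \<Rightarrow> 'v set"
    and mul br :: "'v \<Rightarrow> 'v \<Rightarrow> 'v"
    and \<alpha> :: "'v \<Rightarrow> 'v"
  assumes "gelfand_dorfman_color scale gr eps mul br"
    and "gelfand_dorfman_morphism eps scale gr mul br scale gr mul br \<alpha>"
  shows "hom_gelfand_dorfman_color scale gr eps
           (\<lambda>x y. \<alpha> (mul x y)) (\<lambda>x y. \<alpha> (br x y)) \<alpha> \<and>
         (\<forall>(scale' :: 'k \<Rightarrow> 'w::ab_group_add \<Rightarrow> 'w) (gr' :: 'g \<Rightarrow> 'w set)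
           (mul' :: 'w \<Rightarrow> 'w \<Rightarrow> 'w) (br' :: 'w \<Rightarrow> 'w \<Rightarrow> 'w) (\<alpha>' :: 'w \<Rightarrow> 'w) (f :: 'v \<Rightarrow> 'w).
            gelfand_dorfman_color scale' gr' eps mul' br' \<longrightarrow>
            gelfand_dorfman_morphism eps scale' gr' mul' br' scale' gr' mul' br' \<alpha>' \<longrightarrow>
            gelfand_dorfman_morphism eps scale gr mul br scale' gr' mul' br' f \<longrightarrow>
            f \<circ> \<alpha> = \<alpha>' \<circ> f \<longrightarrow>
            hom_gelfand_dorfman_morphism eps
              scale gr (\<lambda>x y. \<alpha> (mul x y)) (\<lambda>x y. \<alpha> (br x y)) \<alpha>
              scale' gr' (\<lambda>x y. \<alpha>' (mul' x y)) (\<lambda>x y. \<alpha>' (br' x y)) \<alpha>' f)"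
  using assms(2) by (blast intro: hom_gelfand_dorfman_color_twist hom_gelfand_dorfman_morphism_twist)

end
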